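(* Let $d,n,k\ge 1$ and let $T\in\mathrm{TM}_{\rm fix}(\mathbb{Z}^d,n,k)$ be a moving tape Turing machine. Then the following are equivalent: (1) $T$ is injective. (2) $T$ is surjective. (3) $T\in\mathrm{RTM}_{\rm fix}(\mathbb{Z}^d,n,k)$, i.e. $T$ is reversible. (4) $T$ preserves the uniform measure: $\mu(T^{-1}(A))=\mu(A)$ for all Borel sets $A$. (5) $\mu(T(A))=\mu(A)$ for all Borel sets $A$.
   Context: Let $\Sigma=\{0,\dots,n-1\}$, $Q=\{1,\dots,k\}$, and let $\mathbb{Z}^d$ act on $\Sigma^{\mathbb{Z}^d}$ by $(\sigma^{v}(x))_{u}=x_{u-v}$. A moving tape $(\mathbb{Z}^d,n,k)$-Turing machine is a map $T:\Sigma^{\mathbb{Z}^d}\times Q\to\Sigma^{\mathbb{Z}^d}\times Q$ for which there are finite $F_{\rm in},F_{\rm out}\subset\mathbb{Z}^d$ and $f:\Sigma^{F_{\rm in}}\times Q\to\Sigma^{F_{\rm out}}\times Q\times\mathbb{Z}^d$ such that: if $f(x|_{F_{\rm in}},q)=(p,q',v)$ then $T(x,q)=(\sigma^{-v}(y),q')$, where $y_u=p_u$ for $u\in F_{\rm out}$ and $y_u=x_u$ for $u\notin F_{\rm out}$. $\mathrm{TM}_{\rm fix}(\mathbb{Z}^d,n,k)$ is the monoid of all such maps. $T$ is reversible if there is a moving tape $(\mathbb{Z}^d,n,k)$-Turing machine $T^{-1}$ with $T\circ T^{-1}=T^{-1}\circ T=\mathrm{id}$; $\mathrm{RTM}_{\rm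 fix}(\mathbb{Z}^d,n,k)$ is the group of reversible ones. $\mu$ is the uniform measure on $\Sigma^{\mathbb{Z}^d}\times Q$: the product of the uniform Bernoulli measure on $\Sigma^{\mathbb{Z}^d}$ and the uniform probability measure on $Q$, i.e. $\mu(\{x: x|_F=p\}\times\{q\})=\frac{1}{k n^{|F|}}$ for every finite $F\subset\mathbb{Z}^d$, $p\in\Sigma^F$, $q\in Q$. *)

theory Defs
  imports "HOL-Probability.Probability"
begin

text \<open>
  The lattice is the type \<open>int ^ 'd\<close>, whose dimension is the (positive) cardinality of the finite
  type \<open>'d\<close>.  The tape alphabet is the set \<open>{0..<n}\<close> and the state set is \<open>{1..k}\<close>, so a map on
  configurations is a HOL function whose values outside \<open>configs n k\<close> play no role.
\<close>

definition tapes :: "nat \<Rightarrow> (int ^ 'd::finite \<Rightarrow> nat) set" where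
  "tapes n = (UNIV \<rightarrow> {0..<n})"

definition configs :: "nat \<Rightarrow> nat \<Rightarrow> ((int ^ 'd::finite \<Rightarrow> nat) \<times> nat) set" where
  "configs n k = tapes n \<times> {1..k}"

definition shift :: "int ^ 'd \<Rightarrow> (int ^ 'd::finite \<Rightarrow> nat) \<Rightarrow> (int ^ 'd \<Rightarrow> nat)" where
  "shift v x = (\<lambda>u. x (u - v))"

text \<open>
  Patterns on a finite set \<open>F\<close>, i.e. elements of \<open>\<Sigma>\<^sup>F\<close>, are the extensional functions in
  \<open>F \<rightarrow>\<^sub>E {0..<n}\<close>; the term \<open>override_on x p Fout\<close> is the tape agreeing with \<open>p\<close> on \<open>Fout\<close> and
  with \<open>x\<close> elsewhere.
\<close>

definition local_rule_of ::
  "nat \<Rightarrow> nat \<Rightarrow> (int ^ 'd::finite) set \<Rightarrow> (int ^ 'd) set \<Rightarrow>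
   ((int ^ 'd \<Rightarrow> nat) \<times> nat \<Rightarrow> (int ^ 'd \<Rightarrow> nat) \<times> nat \<times> (int ^ 'd)) \<Rightarrow>
   ((int ^ 'd \<Rightarrow> nat) \<times> nat \<Rightarrow> (int ^ 'd \<Rightarrow> nat) \<times> nat) \<Rightarrow> bool"
where
  "local_rule_of n k Fin Fout f T \<longleftrightarrow>
     f \<in> (Fin \<rightarrow>\<^sub>E {0..<n}) \<times> {1..k} \<rightarrow> (Fout \<rightarrow>\<^sub>E {0..<n}) \<times> {1..k} \<times> UNIV \<and>
     (\<forall>x\<in>tapes n. \<forall>q\<in>{1..k}. \<forall>p q' v.
        f (restrict x Fin, q) = (p, q', v) \<longrightarrow>
        T (x, q) = (shift (- v) (override_on x p Fout), q'))"

definition TM_fix ::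
  "nat \<Rightarrow> nat \<Rightarrow> ((int ^ 'd::finite \<Rightarrow> nat) \<times> nat \<Rightarrow> (int ^ 'd \<Rightarrow> nat) \<times> nat) set"
where
  "TM_fix n k = {T. \<exists>Fin Fout f. finite Fin \<and> finite Fout \<and> local_rule_of n k Fin Fout f T}"

definition RTM_fix ::
  "nat \<Rightarrow> nat \<Rightarrow> ((int ^ 'd::finite \<Rightarrow> nat) \<times> nat \<Rightarrow> (int ^ 'd \<Rightarrow> nat) \<times> nat) set"
where
  "RTM_fix n k = {T \<in> TM_fix n k. \<exists>S \<in> TM_fix n k.
     \<forall>c \<in> configs n k. T (S c) = c \<and> S (T c) = c}"

definition uniform_mu ::
  "nat \<Rightarrow> nat \<Rightarrow> ((int ^ 'd::finite \<Rightarrow> nat) \<times> nat) measure"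
where
  "uniform_mu n k =
     (\<Pi>\<^sub>M u\<in>UNIV. uniform_count_measure {0..<n}) \<Otimes>\<^sub>M uniform_count_measure {1..k}"

lemma TM_fix_maps_configs:
  fixes T :: "(int ^ 'd::finite \<Rightarrow> nat) \<times> nat \<Rightarrow> (int ^ 'd \<Rightarrow> nat) \<times> nat"
  assumes "T \<in> TM_fix n k"
  shows "T \<in> configs n k \<rightarrow> configs n k"
proof
  fix c :: "(int ^ 'd \<Rightarrow> nat) \<times> nat" assume c: "c \<in> configs n k"
  obtain x q where xq: "c = (x, q)" "x \<in> tapes n" "q \<in> {1..k}"
    using c by (auto simp: configs_def)
  obtain Fin Fout f where lr: "local_rule_of n k Fin Fout f T"
    using assms unfolding TM_fix_def by blast
  note f = lr[unfolded local_rule_of_def, THEN conjunct1]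
    and T = lr[unfolded local_rule_of_def, THEN conjunct2, rule_format, OF xq(2,3)]
  obtain p q' v where e: "f (restrict x Fin, q) = (p, q', v)"
    by (rule prod_cases3)
  have "(restrict x Fin, q) \<in> (Fin \<rightarrow>\<^sub>E {0..<n}) \<times> {1..k}"
    using xq by (auto simp: tapes_def)
  from Pi_mem[OF f this] have p: "p \<in> Fout \<rightarrow>\<^sub>E {0..<n}" and q': "q' \<in> {1..k}"
    unfolding e by blast+
  have x_in: "x u \<in> {0..<n}" for u
    using xq(2) by (auto simp: tapes_def)
  have "shift (- v) (override_on x p Fout) u \<in> {0..<n}" for u
    using x_in PiE_mem[OF p] unfolding shift_def override_on_def by presburger
  then show "T c \<in> configs n k"
    using q' unfolding xq(1) T[OF e] configs_def tapes_def by blast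
qed

lemma space_uniform_mu: "space (uniform_mu n k) = configs n k"
  by (auto simp: uniform_mu_def configs_def tapes_def space_pair_measure space_PiM
      space_uniform_count_measure)

text \<open>The measurable sets are exactly the Borel sets of the product topology.\<close>

lemma sets_uniform_mu:
  "sets (uniform_mu n k :: ((int ^ 'd::finite \<Rightarrow> nat) \<times> nat) measure)
   = sets (restrict_space borel (configs n k))"
proof -
  let ?M = "uniform_mu n k :: ((int ^ 'd \<Rightarrow> nat) \<times> nat) measure"
  let ?N = "restrict_space borel (configs n k) :: ((int ^ 'd \<Rightarrow> nat) \<times> nat) measure"
  have sp: "space ?M = configs n k" "space ?N = configs n k"
    by (simp_all add: space_uniform_mu space_restrict_space)
  have id1: "(\<lambda>c. c) \<in> measurable ?M ?N"
  proof (rule measurable_restrict_space2)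
    show "(\<lambda>c. c) \<in> space ?M \<rightarrow> configs n k" by (simp add: sp)
    have 1: "(\<lambda>c. fst c i) \<in> measurable ?M borel" for i
    proof -
      have "(\<lambda>c. fst c i) \<in> measurable ?M (uniform_count_measure {0..<n})"
        unfolding uniform_mu_def by measurable
      moreover have "(\<lambda>x. x) \<in> measurable (uniform_count_measure {0..<n}) (borel :: nat measure)"
        by (auto simp: measurable_def space_uniform_count_measure sets_uniform_count_measure)
      ultimately show ?thesis by (rule measurable_compose)
    qed
    have 2: "fst \<in> measurable ?M borel"
      using 1 by (rule measurable_coordinatewise_then_product)
    have 3: "snd \<in> measurable ?M borel"
    proof -
      have "snd \<in> measurable ?M (uniform_count_measure {1..k})"
        unfolding uniform_mu_def by measurable
      moreover have "(\<lambda>x. x) \<in> measurable (uniform_count_measure {1..k}) (borel :: nat measure)"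
        by (auto simp: measurable_def space_uniform_count_measure sets_uniform_count_measure)
      ultimately show ?thesis by (rule measurable_compose)
    qed
    have "(\<lambda>c. (fst c, snd c)) \<in> measurable ?M (borel \<Otimes>\<^sub>M borel)"
      using 2 3 by (rule measurable_Pair)
    then show "(\<lambda>c. c) \<in> borel_measurable ?M"
      by (simp add: borel_prod)
  qed
  have id2: "(\<lambda>c. c) \<in> measurable ?N ?M"
  proof -
    have cont: "continuous_on UNIV (\<lambda>c :: (int ^ 'd \<Rightarrow> nat) \<times> nat. fst c i)" for i
      by (rule continuous_on_product_then_coordinatewise) (intro continuous_intros)
    have b1: "(\<lambda>c. fst c i) \<in> measurable ?N borel" for i
      by (rule measurable_restrict_space1) (rule borel_measurable_continuous_onI[OF cont])
    have b2: "snd \<in> measurable ?N borel"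
      by (rule measurable_restrict_space1) (rule borel_measurable_continuous_onI, intro continuous_intros)
    have nat_sets: "A \<in> sets borel" for A :: "nat set"
      by (rule borel_open) (rule Topological_Spaces.open_discrete)
    have c1: "(\<lambda>c. fst c i) \<in> measurable ?N (uniform_count_measure {0..<n})" for i
    proof (rule measurableI)
      show "fst c i \<in> space (uniform_count_measure {0..<n})" if "c \<in> space ?N" for c
        using that unfolding sp(2) unfolding configs_def tapes_def space_uniform_count_measure by auto
    qed (rule measurable_sets[OF b1 nat_sets])
    have c2: "snd \<in> measurable ?N (uniform_count_measure {1..k})"
    proof (rule measurableI)
      show "snd c \<in> space (uniform_count_measure {1..k})" if "c \<in> space ?N" for c
        using that unfolding sp(2) unfolding configs_def space_uniform_count_measure by auto
    qed (rule measurable_sets[OF b2 nat_sets])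
    have c0: "fst \<in> space ?N \<rightarrow> (\<Pi>\<^sub>E u\<in>UNIV. space (uniform_count_measure {0..<n}))"
      unfolding sp(2) unfolding configs_def tapes_def space_uniform_count_measure by auto
    have "fst \<in> measurable ?N (\<Pi>\<^sub>M u\<in>UNIV. uniform_count_measure {0..<n})"
      by (rule measurable_PiM_single'[OF c1 c0])
    from measurable_Pair[OF this c2] show ?thesis
      by (simp add: uniform_mu_def)
  qed
  have "A \<in> sets ?M \<longleftrightarrow> A \<in> sets ?N" for A
  proof
    assume A: "A \<in> sets ?M"
    show "A \<in> sets ?N"
      using measurable_sets[OF id2 A] sets.sets_into_space[OF A] by (simp add: sp Int_absorb2)
  next
    assume A: "A \<in> sets ?N"
    show "A \<in> sets ?M"
      using measurable_sets[OF id1 A] sets.sets_into_space[OF A] by (simp add: sp Int_absorb2)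
  qed
  then show ?thesis by blast
qed

lemma emeasure_uniform_mu_cylinder:
  fixes F :: "(int ^ 'd::finite) set"
  assumes "n \<ge> 1" "k \<ge> 1" "finite F" "p \<in> F \<rightarrow>\<^sub>E {0..<n}" "q \<in> {1..k}"
  shows "emeasure (uniform_mu n k) ({x \<in> tapes n. restrict x F = p} \<times> {q})
         = ennreal (1 / (real k * real n ^ card F))"
proof -
  let ?U = "uniform_count_measure {0..<n}" and ?S = "uniform_count_measure {1..k}"
  interpret U: prob_space ?U
    by (rule prob_space_uniform_count_measure) (use assms in auto)
  interpret S: prob_space ?S
    by (rule prob_space_uniform_count_measure) (use assms in auto)
  interpret P: product_prob_space "\<lambda>_ :: int ^ 'd. ?U" UNIV
    by unfold_locales
  have cyl: "{x \<in> tapes n. restrict x F = p} = {x \<in> space (PiM UNIV (\<lambda>_. ?U)). \<forall>i\<in>F. x i \<in> {p i}}"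
    using assms(4)
    by (auto simp: tapes_def space_PiM space_uniform_count_measure restrict_def PiE_iff
        extensional_def fun_eq_iff)
  have pin: "p i \<in> {0..<n}" if "i \<in> F" for i
    using assms(4) that by auto
  have E: "emeasure (PiM UNIV (\<lambda>_. ?U)) {x \<in> tapes n. restrict x F = p} = ennreal ((1 / real n) ^ card F)"
    unfolding cyl
    by (subst P.emeasure_PiM_Collect)
       (use assms pin in \<open>auto simp: sets_uniform_count_measure emeasure_uniform_count_measure
          ennreal_power intro!: prod.cong\<close>)
  have meas: "{x \<in> tapes n. restrict x F = p} \<in> sets (PiM UNIV (\<lambda>_ :: int ^ 'd. ?U))"
    unfolding cyl
    by (rule sets.sets_Collect_finite_All[OF _ assms(3)], rule sets_Collect_single)
       (use pin in \<open>simp_all add: sets_uniform_count_measure\<close>)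
  have "emeasure (uniform_mu n k) ({x \<in> tapes n. restrict x F = p} \<times> {q})
        = ennreal ((1 / real n) ^ card F) * emeasure ?S {q}"
    unfolding uniform_mu_def
    by (subst S.emeasure_pair_measure_Times)
       (use meas E assms in \<open>auto simp: sets_uniform_count_measure\<close>)
  also have "emeasure ?S {q} = ennreal (1 / real k)"
    using assms by (subst emeasure_uniform_count_measure) auto
  also have "ennreal ((1 / real n) ^ card F) * ennreal (1 / real k)
             = ennreal (1 / (real k * real n ^ card F))"
    by (simp add: ennreal_mult[symmetric] power_divide mult.commute)
  finally show ?thesis .
qed

end

theory Submission
  imports Defs
begin

text \<open>
  Let \<open>W\<close> be the union of the input window and the output window.  There are finitely many patterns
  on \<open>W\<close>, so the configuration space is a finite disjoint union of cylinders on each of which the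
  rule is constant.  If the tape reads \<open>a\<close> on \<open>W\<close> and the machine writes \<open>p\<close>, moves by \<open>v\<close> and passes
  from state \<open>q\<close> to \<open>q'\<close>, then on that cylinder writing \<open>p\<close> over \<open>a\<close> is the same as transposing the
  symbols \<open>a\<^sub>u\<close> and \<open>p\<^sub>u\<close> in every written cell \<open>u\<close>, and the change of state is the same as
  transposing \<open>q\<close> and \<open>q'\<close>.  These transpositions make sense on all configurations and, together with
  the shift, they form a bijection of the whole space which preserves \<open>\<mu>\<close>
  (\<open>emeasure_local_perm_image\<close>).  So a Turing machine is a bijection of this kind on each cylinder
  of a finite partition \<open>P\<close> (\<open>TM_fix_iff_piecewise_local_perm\<close>), and conversely.

  Hence each image \<open>T ` C\<close> has the measure of \<open>C\<close> and is again determined by finitely many cells, and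
  the measures of the images add up to \<open>1\<close>.  A nonempty set determined by finitely many cells
  contains a cylinder and has positive measure.  If \<open>T\<close> is injective, the images are disjoint, their
  union has measure \<open>1\<close>, and the complement of the union, being null, is empty.  If \<open>T\<close> is
  surjective, the images cover the space with no measure to spare, so their overlaps are null, hence
  empty, and \<open>T\<close> is injective (\<open>inj_on_iff_surj\<close>).  A bijective \<open>T\<close> preserves measure piece by piece,
  its inverse is again piecewise of the special form and therefore a Turing machine, and the
  statement about preimages is the statement about images for the inverse.  Conversely, both
  measure conditions force the complement of the image to be null, which gives surjectivity.
\<close>

section \<open>Permutations of the configuration space\<close>

type_synonym 'd config = "(int ^ 'd \<Rightarrow> nat) \<times> nat"

text \<open>
  The sign of the shift is the one of the moving tape model, so that a machine moving by \<open>v\<close> acts on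
  a cylinder as \<open>local_perm v\<close>.
\<close>

definition local_perm ::
  "int ^ 'd \<Rightarrow> (int ^ 'd \<Rightarrow> nat \<Rightarrow> nat) \<Rightarrow> (nat \<Rightarrow> nat) \<Rightarrow> 'd::finite config \<Rightarrow> 'd config"
where
  "local_perm v \<pi> \<rho> c = (shift (- v) (\<lambda>u. \<pi> u (fst c u)), \<rho> (snd c))"

definition perm_rule ::
  "nat \<Rightarrow> nat \<Rightarrow> (int ^ 'd::finite) set \<Rightarrow> (int ^ 'd \<Rightarrow> nat \<Rightarrow> nat) \<Rightarrow> (nat \<Rightarrow> nat) \<Rightarrow> bool"
where
  "perm_rule n k W \<pi> \<rho> \<longleftrightarrow>
     (\<forall>u. \<pi> u permutes {0..<n}) \<and> (\<forall>u. u \<notin> W \<longrightarrow> \<pi> u = id) \<and> \<rho> permutes {1..k}"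

text \<open>
  The inverse of \<open>local_perm v \<pi> \<rho>\<close> moves back by \<open>v\<close>: what was done in cell \<open>u + v\<close> is to be undone
  in cell \<open>u\<close>, so the permutations and their window are translated by \<open>v\<close>.
\<close>

lemma perm_rule_inverse:
  assumes "perm_rule n k W \<pi> \<rho>"
  shows "perm_rule n k {u. u + v \<in> W} (\<lambda>u. inv (\<pi> (u + v))) (inv \<rho>)"
  using assms by (auto simp: perm_rule_def intro: permutes_inv)

lemma perm_rule_mono: "perm_rule n k W \<pi> \<rho> \<Longrightarrow> W \<subseteq> W' \<Longrightarrow> perm_rule n k W' \<pi> \<rho>"
  by (auto simp: perm_rule_def)

lemma local_perm_inverse:
  assumes "perm_rule n k W \<pi> \<rho>"
  shows "local_perm (- v) (\<lambda>u. inv (\<pi> (u + v))) (inv \<rho>) (local_perm v \<pi> \<rho> c) = c"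
    and "local_perm v \<pi> \<rho> (local_perm (- v) (\<lambda>u. inv (\<pi> (u + v))) (inv \<rho>) c) = c"
proof -
  have \<pi>: "inv (\<pi> u) (\<pi> u a) = a" "\<pi> u (inv (\<pi> u) a) = a" for u a
    using assms permutes_inverses[of "\<pi> u" "{0..<n}"] by (simp_all add: perm_rule_def)
  have \<rho>: "inv \<rho> (\<rho> a) = a" "\<rho> (inv \<rho> a) = a" for a
    using assms permutes_inverses[of \<rho> "{1..k}"] by (simp_all add: perm_rule_def)
  show "local_perm (- v) (\<lambda>u. inv (\<pi> (u + v))) (inv \<rho>) (local_perm v \<pi> \<rho> c) = c"
    and "local_perm v \<pi> \<rho> (local_perm (- v) (\<lambda>u. inv (\<pi> (u + v))) (inv \<rho>) c) = c"
    by (simp_all add: local_perm_def shift_def \<pi> \<rho>)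
qed

lemma local_perm_configs:
  assumes "perm_rule n k W \<pi> \<rho>" and "c \<in> configs n k"
  shows "local_perm v \<pi> \<rho> c \<in> configs n k"
proof -
  have "\<pi> u (fst c u) \<in> {0..<n}" for u
    using assms permutes_in_image[of "\<pi> u" "{0..<n}" "fst c u"]
    by (auto simp: perm_rule_def configs_def tapes_def Pi_iff)
  moreover have "\<rho> (snd c) \<in> {1..k}"
    using assms permutes_in_image[of \<rho> "{1..k}" "snd c"]
    by (auto simp: perm_rule_def configs_def)
  ultimately show ?thesis
    by (auto simp: local_perm_def configs_def tapes_def shift_def Pi_iff)
qed

lemma local_perm_image_eq_vimage:
  assumes "perm_rule n k W \<pi> \<rho>" and "A \<subseteq> configs n k"
  shows "local_perm v \<pi> \<rho> ` A =
    local_perm (- v) (\<lambda>u. inv (\<pi> (u + v))) (inv \<rho>) -` A \<inter> configs n k"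
proof (intro set_eqI iffI)
  let ?R = "local_perm v \<pi> \<rho>" and ?S = "local_perm (- v) (\<lambda>u. inv (\<pi> (u + v))) (inv \<rho>)"
  fix c
  show "c \<in> ?S -` A \<inter> configs n k" if "c \<in> ?R ` A"
    using that assms(2) local_perm_inverse(1)[OF assms(1), of v] local_perm_configs[OF assms(1)]
    by blast
  show "c \<in> ?R ` A" if "c \<in> ?S -` A \<inter> configs n k"
    using that by (intro image_eqI[of _ _ "?S c"]) (simp_all add: local_perm_inverse(2)[OF assms(1)])
qed

section \<open>The uniform measure is invariant\<close>

lemma distr_uniform_count_measure_permutes:
  assumes "p permutes A" and "finite A"
  shows "distr (uniform_count_measure A) (uniform_count_measure A) p = uniform_count_measure A"
proof (rule measure_eqI)
  have meas: "p \<in> measurable (uniform_count_measure A) (uniform_count_measure A)"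
    using permutes_in_image[OF assms(1)]
    by (auto simp: measurable_def space_uniform_count_measure sets_uniform_count_measure)
  fix X assume "X \<in> sets (distr (uniform_count_measure A) (uniform_count_measure A) p)"
  then have X: "X \<subseteq> A" by (simp add: sets_uniform_count_measure)
  have pX: "p -` X \<subseteq> A" using X permutes_in_image[OF assms(1)] by blast
  have "card (p -` X) = card X"
    using permutes_inj[OF assms(1)] permutes_surj[OF assms(1)] by (simp add: card_vimage_inj)
  then show "emeasure (distr (uniform_count_measure A) (uniform_count_measure A) p) X
      = emeasure (uniform_count_measure A) X"
    using X pX assms(2)
    by (simp add: emeasure_distr[OF meas] sets_uniform_count_measure space_uniform_count_measure
        emeasure_uniform_count_measure Int_absorb2)
qed simp

text \<open>
  A product of copies of one uniform measure is invariant under translating the indices and under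
  permuting the alphabet separately in every coordinate, because a box over \<open>J\<close> pulls back to a box
  over the translate \<open>K\<close> of \<open>J\<close> with sides of the same size.
\<close>

lemma distr_PiM_shift_permute:
  fixes \<pi> :: "'i::ab_group_add \<Rightarrow> 'a \<Rightarrow> 'a"
  assumes "finite A" "A \<noteq> {}" and \<pi>: "\<And>u. \<pi> u permutes A"
  defines "U \<equiv> uniform_count_measure A"
  shows "(\<lambda>x u. \<pi> (u + v) (x (u + v))) \<in> measurable (PiM UNIV (\<lambda>_. U)) (PiM UNIV (\<lambda>_. U))"
    and "distr (PiM UNIV (\<lambda>_. U)) (PiM UNIV (\<lambda>_. U)) (\<lambda>x u. \<pi> (u + v) (x (u + v)))
      = PiM UNIV (\<lambda>_. U)"
proof -
  let ?P = "PiM UNIV (\<lambda>_ :: 'i. U)" and ?g = "\<lambda>x u. \<pi> (u + v) (x (u + v))"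
  interpret U: prob_space U
    unfolding U_def by (rule prob_space_uniform_count_measure) fact+
  interpret P: product_prob_space "\<lambda>_ :: 'i. U" UNIV
    by unfold_locales
  have mU: "\<pi> u \<in> measurable U U" for u
    using permutes_in_image[OF \<pi>]
    by (auto simp: U_def measurable_def space_uniform_count_measure sets_uniform_count_measure)
  show g: "?g \<in> measurable ?P ?P"
  proof (rule measurable_PiM_single')
    show "(\<lambda>x. \<pi> (u + v) (x (u + v))) \<in> measurable ?P U" for u
      by (rule measurable_compose[OF _ mU]) simp
    then show "?g \<in> space ?P \<rightarrow> (\<Pi>\<^sub>E u\<in>UNIV. space U)"
      by (auto dest: measurable_space)
  qed
  show "distr ?P ?P ?g = ?P"
  proof (rule P.PiM_eq)
    fix J and X :: "'i \<Rightarrow> 'a set"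
    assume J: "finite J" "J \<subseteq> UNIV" and X: "\<And>i. i \<in> J \<Longrightarrow> X i \<in> sets U"
    define K where "K = (\<lambda>i. i + v) ` J"
    let ?Y = "\<lambda>i. \<pi> i -` X (i - v) \<inter> space U"
    have K: "finite K" "K \<subseteq> UNIV" by (simp_all add: K_def J)
    have Y: "?Y i \<in> sets U" if "i \<in> K" for i
      using that X by (intro measurable_sets[OF mU]) (auto simp: K_def)
    have emb: "prod_emb UNIV (\<lambda>_. U) J (Pi\<^sub>E J X) \<in> sets ?P"
      using J X by (intro sets_PiM_I) auto
    have eq: "?g -` prod_emb UNIV (\<lambda>_. U) J (Pi\<^sub>E J X) \<inter> space ?P
        = {x \<in> space ?P. \<forall>i\<in>K. x i \<in> ?Y i}"
      using measurable_space[OF g]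
      by (auto simp: prod_emb_def K_def space_PiM PiE_iff)
    have "emeasure (distr ?P ?P ?g) (prod_emb UNIV (\<lambda>_. U) J (Pi\<^sub>E J X))
        = (\<Prod>i\<in>K. emeasure U (?Y i))"
      unfolding emeasure_distr[OF g emb] eq by (rule P.emeasure_PiM_Collect[OF K(2,1) Y])
    also have "\<dots> = (\<Prod>i\<in>J. emeasure U (\<pi> (i + v) -` X i \<inter> space U))"
      unfolding K_def by (subst prod.reindex) (auto simp: inj_on_def)
    also have "\<dots> = (\<Prod>i\<in>J. emeasure (distr U U (\<pi> (i + v))) (X i))"
      by (intro prod.cong refl) (simp add: emeasure_distr[OF mU X])
    also have "\<dots> = (\<Prod>i\<in>J. emeasure U (X i))"
      using distr_uniform_count_measure_permutes[OF \<pi> assms(1)] by (simp add: U_def)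
    finally show "emeasure (distr ?P ?P ?g) (prod_emb UNIV (\<lambda>_. U) J (Pi\<^sub>E J X))
        = (\<Prod>i\<in>J. emeasure U (X i))" .
  qed simp
qed

lemma local_perm_preserves_mu:
  fixes \<pi> :: "int ^ 'd::finite \<Rightarrow> nat \<Rightarrow> nat"
  assumes "n \<ge> 1" "k \<ge> 1" "perm_rule n k W \<pi> \<rho>"
  shows "local_perm v \<pi> \<rho> \<in> measurable (uniform_mu n k) (uniform_mu n k)"
    and "distr (uniform_mu n k) (uniform_mu n k) (local_perm v \<pi> \<rho>) = uniform_mu n k"
proof -
  let ?U = "uniform_count_measure {0..<n}" and ?S = "uniform_count_measure {1..k}"
  let ?P = "PiM UNIV (\<lambda>_ :: int ^ 'd. ?U)" and ?g = "\<lambda>x u. \<pi> (u + v) (x (u + v))"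
  interpret S: prob_space ?S
    by (rule prob_space_uniform_count_measure) (use assms in auto)
  have \<rho>: "\<rho> permutes {1..k}" and \<pi>: "\<And>u. \<pi> u permutes {0..<n}"
    using assms(3) by (auto simp: perm_rule_def)
  have A: "finite {0..<n}" "{0..<n} \<noteq> {}" using assms by auto
  note g = distr_PiM_shift_permute[where \<pi> = \<pi>, OF A \<pi>, of v]
  have meas_\<rho>: "\<rho> \<in> measurable ?S ?S"
    using permutes_in_image[OF \<rho>]
    by (auto simp: measurable_def space_uniform_count_measure sets_uniform_count_measure)
  have distr_\<rho>: "distr ?S ?S \<rho> = ?S"
    by (rule distr_uniform_count_measure_permutes[OF \<rho>]) simp
  have eq: "local_perm v \<pi> \<rho> = (\<lambda>(x, y). (?g x, \<rho> y))"
    by (auto simp: local_perm_def shift_def)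
  show "local_perm v \<pi> \<rho> \<in> measurable (uniform_mu n k) (uniform_mu n k)"
    unfolding eq uniform_mu_def using g(1) meas_\<rho> by measurable
  have "?P \<Otimes>\<^sub>M ?S = distr ?P ?P ?g \<Otimes>\<^sub>M distr ?S ?S \<rho>"
    unfolding g(2) distr_\<rho> ..
  also have "\<dots> = distr (?P \<Otimes>\<^sub>M ?S) (?P \<Otimes>\<^sub>M ?S) (\<lambda>(x, y). (?g x, \<rho> y))"
    by (rule pair_measure_distr[OF g(1) meas_\<rho>])
       (unfold distr_\<rho>, rule S.sigma_finite_measure_axioms)
  finally show "distr (uniform_mu n k) (uniform_mu n k) (local_perm v \<pi> \<rho>) = uniform_mu n k"
    by (simp add: eq uniform_mu_def)
qed

lemma emeasure_local_perm_image:
  fixes \<pi> :: "int ^ 'd::finite \<Rightarrow> nat \<Rightarrow> nat"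
  assumes "n \<ge> 1" "k \<ge> 1" "perm_rule n k W \<pi> \<rho>" "A \<in> sets (uniform_mu n k)"
  shows "local_perm v \<pi> \<rho> ` A \<in> sets (uniform_mu n k)"
    and "emeasure (uniform_mu n k) (local_perm v \<pi> \<rho> ` A) = emeasure (uniform_mu n k) A"
proof -
  let ?S = "local_perm (- v) (\<lambda>u. inv (\<pi> (u + v))) (inv \<rho>)"
  note S = local_perm_preserves_mu[OF assms(1,2) perm_rule_inverse[OF assms(3), of v], of "- v"]
  have "A \<subseteq> configs n k"
    using sets.sets_into_space[OF assms(4)] by (simp add: space_uniform_mu)
  then have im: "local_perm v \<pi> \<rho> ` A = ?S -` A \<inter> space (uniform_mu n k)"
    using local_perm_image_eq_vimage[OF assms(3)] by (simp add: space_uniform_mu)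
  show "local_perm v \<pi> \<rho> ` A \<in> sets (uniform_mu n k)"
    unfolding im by (rule measurable_sets[OF S(1) assms(4)])
  show "emeasure (uniform_mu n k) (local_perm v \<pi> \<rho> ` A) = emeasure (uniform_mu n k) A"
    unfolding im using emeasure_distr[OF S(1) assms(4)] S(2) by simp
qed

section \<open>Sets determined by a finite window\<close>

definition cylinder :: "nat \<Rightarrow> nat \<Rightarrow> (int ^ 'd::finite) set \<Rightarrow> 'd config \<Rightarrow> 'd config set" where
  "cylinder n k W c = {c' \<in> configs n k. (\<forall>u\<in>W. fst c' u = fst c u) \<and> snd c' = snd c}"

text \<open>
  For finite \<open>W\<close> the determined sets are the clopen sets which \<open>W\<close> and the state decide.
\<close>

definition determined :: "nat \<Rightarrow> nat \<Rightarrow> (int ^ 'd::finite) set \<Rightarrow> 'd config set \<Rightarrow> bool" where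
  "determined n k W A \<longleftrightarrow> A \<subseteq> configs n k \<and> (\<forall>c\<in>A. cylinder n k W c \<subseteq> A)"

lemma cylinder_eq_pattern:
  "cylinder n k W c = {x \<in> tapes n. restrict x W = restrict (fst c) W} \<times> {snd c}"
  if "c \<in> configs n k"
proof -
  have "restrict x W = restrict (fst c) W \<longleftrightarrow> (\<forall>u\<in>W. x u = fst c u)" for x
    by (metis restrict_apply' restrict_ext)
  then show ?thesis
    using that by (auto simp: cylinder_def configs_def)
qed

lemma emeasure_cylinder:
  assumes "n \<ge> 1" "k \<ge> 1" "finite W" "c \<in> configs n k"
  shows "cylinder n k W c \<in> sets (uniform_mu n k)"
    and "emeasure (uniform_mu n k) (cylinder n k W c) > 0"
proof -
  have "emeasure (uniform_mu n k) (cylinder n k W c) = ennreal (1 / (real k * real n ^ card W))"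
    unfolding cylinder_eq_pattern[OF assms(4)]
    by (rule emeasure_uniform_mu_cylinder)
       (use assms in \<open>auto simp: configs_def tapes_def Pi_iff\<close>)
  then show pos: "emeasure (uniform_mu n k) (cylinder n k W c) > 0"
    using assms(1,2) by (simp del: of_nat_power)
  then show "cylinder n k W c \<in> sets (uniform_mu n k)"
    by (rule emeasure_neq_0_sets[OF less_imp_neq[THEN not_sym]])
qed

lemma finite_cylinders:
  fixes W :: "(int ^ 'd::finite) set"
  assumes "finite W"
  shows "finite (cylinder n k W ` configs n k)"
proof -
  let ?pat = "\<lambda>c :: 'd config. (restrict (fst c) W, snd c)"
  have "?pat ` configs n k \<subseteq> (W \<rightarrow>\<^sub>E {0..<n}) \<times> {1..k}"
    by (auto simp: configs_def tapes_def)
  then have "finite (?pat ` configs n k)"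
    by (rule finite_subset) (intro finite_cartesian_product finite_PiE assms; simp)
  moreover have "cylinder n k W ` configs n k
      = (\<lambda>(p, q). {x \<in> tapes n. restrict x W = p} \<times> {q}) ` ?pat ` configs n k"
    by (auto simp: cylinder_eq_pattern image_image)
  ultimately show ?thesis by simp
qed

lemma determined_sets:
  assumes "n \<ge> 1" "k \<ge> 1" "finite W" "determined n k W A"
  shows "A \<in> sets (uniform_mu n k)"
proof -
  have "A = \<Union> (cylinder n k W ` A)"
    using assms(4) by (auto simp: determined_def cylinder_def)
  moreover have "finite (cylinder n k W ` A)"
    by (rule finite_subset[OF _ finite_cylinders[OF assms(3)]]) (use assms(4) in \<open>auto simp: determined_def\<close>)
  moreover have "cylinder n k W ` A \<subseteq> sets (uniform_mu n k)"
    using assms(4) emeasure_cylinder(1)[OF assms(1-3)] by (auto simp: determined_def)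
  ultimately show ?thesis by (metis sets.finite_Union)
qed

text \<open>
  This turns conclusions that hold up to null sets into exact ones: a nonempty determined set
  contains a cylinder, and cylinders have positive measure.
\<close>

lemma determined_null_imp_empty:
  assumes "n \<ge> 1" "k \<ge> 1" "finite W" "determined n k W A" "emeasure (uniform_mu n k) A = 0"
  shows "A = {}"
proof (rule ccontr)
  assume "A \<noteq> {}"
  then obtain c where c: "c \<in> A" by blast
  then have "emeasure (uniform_mu n k) (cylinder n k W c) \<le> emeasure (uniform_mu n k) A"
    using assms by (intro emeasure_mono determined_sets[OF assms(1-4)]) (auto simp: determined_def)
  moreover have "emeasure (uniform_mu n k) (cylinder n k W c) > 0"
    using c assms by (intro emeasure_cylinder) (auto simp: determined_def)
  ultimately show False using assms(5) by simp
qed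

lemma determined_mono: "determined n k W A \<Longrightarrow> W \<subseteq> W' \<Longrightarrow> determined n k W' A"
  unfolding determined_def cylinder_def by blast

lemma determined_Int: "determined n k W A \<Longrightarrow> determined n k W B \<Longrightarrow> determined n k W (A \<inter> B)"
  unfolding determined_def by blast

lemma determined_Union: "(\<And>A. A \<in> \<A> \<Longrightarrow> determined n k W A) \<Longrightarrow> determined n k W (\<Union> \<A>)"
  unfolding determined_def by blast

lemma determined_compl: "determined n k W A \<Longrightarrow> determined n k W (configs n k - A)"
  unfolding determined_def cylinder_def by (auto simp: subset_iff)

lemma determined_cylinder: "determined n k W (cylinder n k W c)"
  unfolding determined_def cylinder_def by auto

lemma local_perm_cylinder:
  assumes "perm_rule n k W' \<pi> \<rho>" "c' \<in> cylinder n k {u. u + v \<in> W} (local_perm v \<pi> \<rho> c)"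
  shows "local_perm (- v) (\<lambda>u. inv (\<pi> (u + v))) (inv \<rho>) c' \<in> cylinder n k W c"
proof -
  let ?S = "local_perm (- v) (\<lambda>u. inv (\<pi> (u + v))) (inv \<rho>)"
  have c': "c' \<in> configs n k"
    and agree: "\<And>u. u + v \<in> W \<Longrightarrow> fst c' u = fst (local_perm v \<pi> \<rho> c) u"
    and st: "snd c' = snd (local_perm v \<pi> \<rho> c)"
    using assms(2) by (auto simp: cylinder_def)
  have "fst (?S c') u = fst (?S (local_perm v \<pi> \<rho> c)) u" if "u \<in> W" for u
    using agree[of "u - v"] that by (simp add: local_perm_def[of "- v"] shift_def)
  moreover have "snd (?S c') = snd (?S (local_perm v \<pi> \<rho> c))"
    using st by (simp add: local_perm_def[of "- v"])
  ultimately show ?thesis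
    using local_perm_configs[OF perm_rule_inverse[OF assms(1)] c'] local_perm_inverse(1)[OF assms(1)]
    by (simp add: cylinder_def)
qed

text \<open>
  To decide whether \<open>c\<close> lies in the image, apply the inverse permutation: its cells in \<open>W\<close> depend only
  on the cells of \<open>c\<close> in the translate of \<open>W\<close>.
\<close>

lemma determined_local_perm_image:
  assumes "perm_rule n k W' \<pi> \<rho>" "determined n k W A"
  shows "determined n k {u. u + v \<in> W} (local_perm v \<pi> \<rho> ` A)"
  unfolding determined_def
proof (intro conjI ballI subsetI)
  fix c assume "c \<in> local_perm v \<pi> \<rho> ` A"
  then obtain a where "a \<in> A" "c = local_perm v \<pi> \<rho> a" by blast
  moreover from this have "a \<in> configs n k"
    using assms(2) by (auto simp: determined_def)
  ultimately show "c \<in> configs n k"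
    using local_perm_configs[OF assms(1)] by simp
next
  fix c c' assume "c \<in> local_perm v \<pi> \<rho> ` A" and c': "c' \<in> cylinder n k {u. u + v \<in> W} c"
  then obtain a where a: "a \<in> A" "c = local_perm v \<pi> \<rho> a" by blast
  from local_perm_cylinder[OF assms(1) c'[unfolded a(2)]] a(1) assms(2)
  have "local_perm (- v) (\<lambda>u. inv (\<pi> (u + v))) (inv \<rho>) c' \<in> A"
    unfolding determined_def by blast
  then show "c' \<in> local_perm v \<pi> \<rho> ` A"
    using local_perm_inverse(2)[OF assms(1), of v c'] by (metis image_eqI)
qed

section \<open>Turing machines are piecewise permutations\<close>

text \<open>
  From left to right, the transpositions of the symbols read with the symbols written realise the
  rule on a cylinder.  From right to left, a rule is read off by extending each pattern to a
  configuration; all extensions lie in one cylinder, so the choice does not matter.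
\<close>

lemma TM_fix_iff_piecewise_local_perm:
  fixes T :: "'d::finite config \<Rightarrow> 'd config"
  assumes "n \<ge> 1"
  shows "T \<in> TM_fix n k \<longleftrightarrow>
    (\<exists>W. finite W \<and> (\<forall>c\<in>configs n k. \<exists>v \<pi> \<rho>. perm_rule n k W \<pi> \<rho> \<and>
       (\<forall>c'\<in>cylinder n k W c. T c' = local_perm v \<pi> \<rho> c')))"
proof
  assume "T \<in> TM_fix n k"
  then obtain Fin Fout f where fin: "finite Fin" "finite Fout" and lr: "local_rule_of n k Fin Fout f T"
    unfolding TM_fix_def by blast
  note f = lr[unfolded local_rule_of_def, THEN conjunct1]
    and T = lr[unfolded local_rule_of_def, THEN conjunct2, rule_format]
  let ?W = "Fin \<union> Fout"
  have "\<exists>v \<pi> \<rho>. perm_rule n k ?W \<pi> \<rho> \<and> (\<forall>c'\<in>cylinder n k ?W c. T c' = local_perm v \<pi> \<rho> c')"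
    if c: "c \<in> configs n k" for c
  proof -
    obtain x q where xq: "c = (x, q)" "x \<in> tapes n" "q \<in> {1..k}"
      using c by (auto simp: configs_def)
    obtain p q' v where e: "f (restrict x Fin, q) = (p, q', v)"
      by (rule prod_cases3)
    have "(restrict x Fin, q) \<in> (Fin \<rightarrow>\<^sub>E {0..<n}) \<times> {1..k}"
      using xq by (auto simp: tapes_def)
    from Pi_mem[OF f this] have p: "p \<in> Fout \<rightarrow>\<^sub>E {0..<n}" and q': "q' \<in> {1..k}"
      unfolding e by blast+
    define \<pi> where "\<pi> u = (if u \<in> Fout then Transposition.transpose (x u) (p u) else id)" for u
    define \<rho> where "\<rho> = Transposition.transpose q q'"
    have "\<pi> u permutes {0..<n}" for u
    proof (cases "u \<in> Fout")
      case True
      then show ?thesis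
        using xq(2) PiE_mem[OF p True] by (auto simp: \<pi>_def tapes_def Pi_iff intro!: permutes_swap_id)
    qed (simp add: \<pi>_def permutes_id)
    moreover have "\<rho> permutes {1..k}"
      unfolding \<rho>_def by (rule permutes_swap_id) fact+
    ultimately have "perm_rule n k ?W \<pi> \<rho>"
      by (simp add: perm_rule_def \<pi>_def)
    moreover have "T c' = local_perm v \<pi> \<rho> c'" if c': "c' \<in> cylinder n k ?W c" for c'
    proof -
      obtain y where y: "c' = (y, q)" "y \<in> tapes n" "\<And>u. u \<in> ?W \<Longrightarrow> y u = x u"
        using c' xq(1) by (cases c') (auto simp: cylinder_def configs_def)
      have "restrict y Fin = restrict x Fin"
        using y(3) by (auto simp: restrict_def)
      then have "T c' = (shift (- v) (override_on y p Fout), q')"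
        using T[OF y(2) xq(3)] e y(1) by simp
      moreover have "override_on y p Fout = (\<lambda>u. \<pi> u (y u))"
        using y(3) by (auto simp: override_on_def \<pi>_def)
      ultimately show ?thesis
        by (simp add: local_perm_def y(1) \<rho>_def)
    qed
    ultimately show ?thesis by blast
  qed
  then show "\<exists>W. finite W \<and> (\<forall>c\<in>configs n k. \<exists>v \<pi> \<rho>. perm_rule n k W \<pi> \<rho> \<and>
       (\<forall>c'\<in>cylinder n k W c. T c' = local_perm v \<pi> \<rho> c'))"
    using fin by (intro exI[of _ ?W]) auto
next
  assume "\<exists>W. finite W \<and> (\<forall>c\<in>configs n k. \<exists>v \<pi> \<rho>. perm_rule n k W \<pi> \<rho> \<and>
       (\<forall>c'\<in>cylinder n k W c. T c' = local_perm v \<pi> \<rho> c'))"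
  then obtain W v \<pi> \<rho> where fin: "finite W"
    and rule: "\<And>c. c \<in> configs n k \<Longrightarrow> perm_rule n k W (\<pi> c) (\<rho> c)"
    and T: "\<And>c c'. c \<in> configs n k \<Longrightarrow> c' \<in> cylinder n k W c \<Longrightarrow>
              T c' = local_perm (v c) (\<pi> c) (\<rho> c) c'"
    by metis
  \<comment> \<open>Any symbol of the alphabet would do outside \<open>W\<close>; \<open>n \<ge> 1\<close> makes \<open>0\<close> one.\<close>
  define ext :: "'d config \<Rightarrow> 'd config" where
    "ext = (\<lambda>(p, q). (override_on (\<lambda>_. 0) p W, q))"
  define f where "f c = (restrict (\<lambda>u. \<pi> (ext c) u (fst c u)) W, \<rho> (ext c) (snd c), v (ext c))" for c
  have ext: "ext c \<in> configs n k" if "c \<in> (W \<rightarrow>\<^sub>E {0..<n}) \<times> {1..k}" for c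
    using that assms by (auto simp: ext_def configs_def tapes_def override_on_def)
  have "f c \<in> (W \<rightarrow>\<^sub>E {0..<n}) \<times> {1..k} \<times> UNIV" if c: "c \<in> (W \<rightarrow>\<^sub>E {0..<n}) \<times> {1..k}" for c
  proof -
    have "\<pi> (ext c) u permutes {0..<n}" "\<rho> (ext c) permutes {1..k}" for u
      using rule[OF ext[OF c]] by (auto simp: perm_rule_def)
    moreover have "fst c u \<in> {0..<n}" if "u \<in> W" for u
      using c that by auto
    moreover have "snd c \<in> {1..k}"
      using c by auto
    ultimately have "\<And>u. u \<in> W \<Longrightarrow> \<pi> (ext c) u (fst c u) \<in> {0..<n}"
        "\<rho> (ext c) (snd c) \<in> {1..k}"
      by (simp_all only: permutes_in_image)
    then show ?thesis by (auto simp: f_def)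
  qed
  moreover have "T (x, q) = (shift (- w) (override_on x p W), q')"
    if xq: "x \<in> tapes n" "q \<in> {1..k}" and e: "f (restrict x W, q) = (p, q', w)" for x q p q' w
  proof -
    let ?c = "ext (restrict x W, q)"
    have c: "?c \<in> configs n k"
      by (rule ext) (use xq in \<open>auto simp: tapes_def\<close>)
    have "(x, q) \<in> cylinder n k W ?c"
      using xq by (auto simp: cylinder_def configs_def ext_def)
    from T[OF c this] have "T (x, q) = (shift (- v ?c) (\<lambda>u. \<pi> ?c u (x u)), \<rho> ?c q)"
      by (simp add: local_perm_def)
    moreover have "(\<lambda>u. \<pi> ?c u (x u)) = override_on x p W"
      using rule[OF c] e by (auto simp: f_def override_on_def perm_rule_def)
    ultimately show ?thesis using e by (simp add: f_def)
  qed
  ultimately have "local_rule_of n k W W f T"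
    unfolding local_rule_of_def by blast
  then show "T \<in> TM_fix n k"
    using fin unfolding TM_fix_def by blast
qed

text \<open>
  What the equivalences use of a Turing machine: its pieces, and the permutations only so far as they
  invert \<open>T\<close> on the images of the pieces.  One window \<open>W\<close> serves for the pieces, their images and the
  inverse permutations, so that unions, intersections and complements stay determined by \<open>W\<close>.
\<close>

locale permutation_pieces =
  fixes n k :: nat and T :: "'d::finite config \<Rightarrow> 'd config"
    and P :: "'d config set set" and W :: "(int ^ 'd) set"
  assumes n_pos: "n \<ge> 1" and k_pos: "k \<ge> 1"
    and finite_P: "finite P" and disjoint_P: "disjoint P" and cover: "\<Union> P = configs n k"
    and finite_W: "finite W"
    and piece_determined: "C \<in> P \<Longrightarrow> determined n k W C"
    and image_determined: "C \<in> P \<Longrightarrow> determined n k W (T ` C)"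
    and image_preserves: "C \<in> P \<Longrightarrow> A \<subseteq> C \<Longrightarrow> A \<in> sets (uniform_mu n k) \<Longrightarrow>
      T ` A \<in> sets (uniform_mu n k) \<and>
      emeasure (uniform_mu n k) (T ` A) = emeasure (uniform_mu n k) A"
    and inv_piece: "C \<in> P \<Longrightarrow>
      \<exists>v \<pi> \<rho>. perm_rule n k W \<pi> \<rho> \<and> (\<forall>c\<in>C. local_perm v \<pi> \<rho> (T c) = c)"

lemma TM_fix_imp_permutation_pieces:
  fixes T :: "'d::finite config \<Rightarrow> 'd config"
  assumes "n \<ge> 1" "k \<ge> 1" "T \<in> TM_fix n k"
  obtains P W where "permutation_pieces n k T P W"
proof -
  obtain W where finW: "finite W" and loc: "\<And>c. c \<in> configs n k \<Longrightarrow> \<exists>v \<pi> \<rho>. perm_rule n k W \<pi> \<rho> \<and>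
       (\<forall>c'\<in>cylinder n k W c. T c' = local_perm v \<pi> \<rho> c')"
    using assms(3) unfolding TM_fix_iff_piecewise_local_perm[OF assms(1)] by blast
  define P where "P = cylinder n k W ` configs n k"
  have "\<forall>C\<in>P. \<exists>v \<pi> \<rho>. perm_rule n k W \<pi> \<rho> \<and> (\<forall>c\<in>C. T c = local_perm v \<pi> \<rho> c)"
    using loc by (auto simp: P_def)
  then obtain v \<pi> \<rho> where rule: "\<And>C. C \<in> P \<Longrightarrow> perm_rule n k W (\<pi> C) (\<rho> C)"
    and T: "\<And>C c. C \<in> P \<Longrightarrow> c \<in> C \<Longrightarrow> T c = local_perm (v C) (\<pi> C) (\<rho> C) c"
    by metis
  \<comment> \<open>The images of the pieces and the inverse permutations live on the translates of \<open>W\<close>.\<close>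
  define W' where "W' = W \<union> (\<Union>C\<in>P. {u. u + v C \<in> W})"
  have finP: "finite P"
    unfolding P_def by (rule finite_cylinders[OF finW])
  have "{u. u + w \<in> W} = (\<lambda>u. u - w) ` W" for w
    by (auto simp: image_iff) (metis add_diff_cancel_right')
  then have finW': "finite W'"
    using finP finW by (simp add: W'_def)
  have shifted: "{u. u + v C \<in> W} \<subseteq> W'" if "C \<in> P" for C
    using that by (auto simp: W'_def)
  have img: "T ` A = local_perm (v C) (\<pi> C) (\<rho> C) ` A" if "C \<in> P" "A \<subseteq> C" for C A
    using T that by (intro image_cong) auto
  show thesis
  proof (rule that, unfold_locales)
    show "finite P" "finite W'" "n \<ge> 1" "k \<ge> 1" by fact+
    show "disjoint P"
      unfolding P_def disjoint_def by (auto simp: cylinder_def)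
    show "\<Union> P = configs n k"
      by (auto simp: P_def cylinder_def)
    show "determined n k W' C" if "C \<in> P" for C
    proof (rule determined_mono)
      show "determined n k W C"
        using that determined_cylinder by (auto simp: P_def)
    qed (simp add: W'_def)
    show "determined n k W' (T ` C)" if "C \<in> P" for C
    proof (rule determined_mono)
      show "determined n k {u. u + v C \<in> W} (T ` C)"
        unfolding img[OF that order_refl]
        using that determined_cylinder
        by (intro determined_local_perm_image[OF rule[OF that]]) (auto simp: P_def)
    qed (rule shifted[OF that])
    show "T ` A \<in> sets (uniform_mu n k) \<and>
        emeasure (uniform_mu n k) (T ` A) = emeasure (uniform_mu n k) A"
      if "C \<in> P" "A \<subseteq> C" "A \<in> sets (uniform_mu n k)" for C A
      unfolding img[OF that(1,2)]
      using emeasure_local_perm_image[OF assms(1,2) rule[OF that(1)] that(3)] by blast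
    show "\<exists>v' \<pi>' \<rho>'. perm_rule n k W' \<pi>' \<rho>' \<and> (\<forall>c\<in>C. local_perm v' \<pi>' \<rho>' (T c) = c)"
      if C: "C \<in> P" for C
      using perm_rule_mono[OF perm_rule_inverse[OF rule[OF C]] shifted[OF C]]
        T[OF C] local_perm_inverse(1)[OF rule[OF C]]
      by metis
  qed
qed

section \<open>The equivalences\<close>

lemma inv_into_image_eq_vimage:
  assumes "bij_betw f X Y" "A \<subseteq> Y"
  shows "inv_into X f ` A = f -` A \<inter> X"
proof (intro set_eqI iffI)
  fix x
  show "x \<in> f -` A \<inter> X" if "x \<in> inv_into X f ` A"
    using that assms by (auto simp: bij_betw_def f_inv_into_f inv_into_into subset_iff)
  show "x \<in> inv_into X f ` A" if "x \<in> f -` A \<inter> X"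
    using that assms by (intro image_eqI[of _ _ "f x"]) (auto simp: bij_betw_def)
qed

lemma prob_space_uniform_mu:
  assumes "n \<ge> 1" "k \<ge> 1"
  shows "prob_space (uniform_mu n k :: 'd::finite config measure)"
proof -
  let ?U = "uniform_count_measure {0..<n}" and ?S = "uniform_count_measure {1..k}"
  interpret tape: prob_space "PiM UNIV (\<lambda>_ :: int ^ 'd. ?U)"
    by (rule prob_space_PiM, rule prob_space_uniform_count_measure) (use assms in auto)
  interpret S: prob_space ?S
    by (rule prob_space_uniform_count_measure) (use assms in auto)
  interpret pair_prob_space "PiM UNIV (\<lambda>_ :: int ^ 'd. ?U)" ?S ..
  show ?thesis
    unfolding uniform_mu_def by (rule prob_space_axioms)
qed

context permutation_pieces
begin

lemma image_configs: "T ` configs n k = (\<Union>C\<in>P. T ` C)"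
  using cover by blast

lemma determined_image_configs: "determined n k W (T ` configs n k)"
  unfolding image_configs using image_determined by (intro determined_Union) auto

lemma image_subset: "T ` configs n k \<subseteq> configs n k"
  using determined_image_configs by (simp add: determined_def)

text \<open>
  Injectivity says that the images of the pieces do not overlap, surjectivity that they leave no
  gap.  As their measures add up to \<open>1\<close>, a gap is null exactly if the overlaps are null; both are
  determined sets, so null means empty.
\<close>

lemma inj_on_iff_surj:
  "inj_on T (configs n k) \<longleftrightarrow> T ` configs n k = configs n k"
proof -
  let ?M = "uniform_mu n k :: 'd config measure"
  interpret M: prob_space ?M
    by (rule prob_space_uniform_mu[OF n_pos k_pos])
  note sets = determined_sets[OF n_pos k_pos finite_W]
  have total: "(\<Sum>C\<in>P. M.prob (T ` C)) = 1"
  proof -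
    have "(\<Sum>C\<in>P. M.prob (T ` C)) = (\<Sum>C\<in>P. M.prob C)"
      using image_preserves[OF _ order_refl sets[OF piece_determined]]
      by (intro sum.cong) (auto simp: measure_def)
    also have "\<dots> = M.prob (\<Union>C\<in>P. C)"
      using finite_P disjoint_P sets[OF piece_determined]
      by (intro M.finite_measure_finite_Union[symmetric]) (auto simp: disjoint_family_on_def disjoint_def)
    also have "\<dots> = 1"
      using M.prob_space cover by (simp add: space_uniform_mu)
    finally show ?thesis .
  qed
  show ?thesis
  proof
    assume inj: "inj_on T (configs n k)"
    let ?N = "configs n k - T ` configs n k"
    have "disjoint_family_on (\<lambda>C. T ` C) P"
      unfolding disjoint_family_on_def
    proof (intro ballI impI)
      fix C D assume "C \<in> P" "D \<in> P" "C \<noteq> D"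
      then have "C \<inter> D = {}" "C \<subseteq> configs n k" "D \<subseteq> configs n k"
        using disjoint_P cover by (auto simp: disjoint_def)
      then show "T ` C \<inter> T ` D = {}"
        using inj_on_image_Int[OF inj, of C D] by simp
    qed
    then have "M.prob (T ` configs n k) = 1"
      using finite_P sets[OF image_determined] total unfolding image_configs
      by (subst M.finite_measure_finite_Union) auto
    then have "emeasure ?M ?N = 0"
      using M.prob_compl[OF sets[OF determined_image_configs]]
      by (simp add: M.emeasure_eq_measure space_uniform_mu)
    then have "?N = {}"
      by (rule determined_null_imp_empty[OF n_pos k_pos finite_W
            determined_compl[OF determined_image_configs]])
    then show "T ` configs n k = configs n k"
      using image_subset by blast
  next
    assume surj: "T ` configs n k = configs n k"
    have meet: "C = D" if CD: "C \<in> P" "D \<in> P" "T ` C \<inter> T ` D \<noteq> {}" for C D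
    proof (rule ccontr)
      assume neq: "C \<noteq> D"
      let ?I = "T ` C \<inter> T ` D"
      have I: "determined n k W ?I"
        using CD image_determined by (intro determined_Int)
      have "emeasure ?M ?I \<noteq> 0"
        using determined_null_imp_empty[OF n_pos k_pos finite_W I] CD(3) by blast
      then have pos: "M.prob ?I > 0"
        by (simp add: M.emeasure_eq_measure zero_less_measure_iff)
      have "1 = M.prob (T ` configs n k)"
        using M.prob_space by (simp add: surj space_uniform_mu)
      \<comment> \<open>The overlap with \<open>T ` C\<close> may be removed from \<open>T ` D\<close> without uncovering anything.\<close>
      also have "T ` configs n k = (\<Union>B\<in>P - {D}. T ` B) \<union> (T ` D - ?I)"
        unfolding image_configs using CD neq by blast
      also have "M.prob \<dots> \<le> M.prob (\<Union>B\<in>P - {D}. T ` B) + M.prob (T ` D - ?I)"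
        using finite_P CD sets[OF image_determined] sets[OF I]
        by (intro measure_Un_le) (auto intro!: sets.finite_UN)
      also have "\<dots> \<le> (\<Sum>B\<in>P - {D}. M.prob (T ` B)) + (M.prob (T ` D) - M.prob ?I)"
        using finite_P CD sets[OF image_determined] sets[OF I]
        by (intro add_mono M.finite_measure_subadditive_finite) (auto simp: M.finite_measure_Diff)
      also have "\<dots> = 1 - M.prob ?I"
        using total finite_P CD by (simp add: sum_diff1)
      finally show False using pos by simp
    qed
    show "inj_on T (configs n k)"
    proof (rule inj_onI)
      fix c d assume cd: "c \<in> configs n k" "d \<in> configs n k" and eq: "T c = T d"
      then obtain C D where CD: "C \<in> P" "c \<in> C" "D \<in> P" "d \<in> D"
        using cover by blast
      have "T c \<in> T ` C \<inter> T ` D"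
        using imageI[OF CD(2), of T] imageI[OF CD(4), of T] eq by simp
      then have "C = D"
        using CD by (intro meet) auto
      then show "c = d"
        using inv_piece[OF CD(1)] CD eq by metis
    qed
  qed
qed

lemma measure_image:
  assumes "inj_on T (configs n k)" "A \<in> sets (uniform_mu n k)"
  shows "T ` A \<in> sets (uniform_mu n k)"
    and "emeasure (uniform_mu n k) (T ` A) = emeasure (uniform_mu n k) A"
proof -
  let ?M = "uniform_mu n k :: 'd config measure"
  have A: "A \<subseteq> configs n k"
    using sets.sets_into_space[OF assms(2)] by (simp add: space_uniform_mu)
  have piece: "A \<inter> C \<in> sets ?M" if "C \<in> P" for C
    using assms(2) determined_sets[OF n_pos k_pos finite_W piece_determined[OF that]] by blast
  note pres' = image_preserves[OF _ Int_lower2 piece]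
  have A_eq: "A = (\<Union>C\<in>P. A \<inter> C)" and im_eq: "T ` A = (\<Union>C\<in>P. T ` (A \<inter> C))"
    using A cover by blast+
  show "T ` A \<in> sets ?M"
    unfolding im_eq using finite_P pres' by (intro sets.finite_UN) auto
  have d: "disjoint_family_on (\<lambda>C. A \<inter> C) P"
    using disjoint_P by (auto simp: disjoint_family_on_def disjoint_def)
  have d': "disjoint_family_on (\<lambda>C. T ` (A \<inter> C)) P"
    unfolding disjoint_family_on_def
  proof (intro ballI impI)
    fix C D assume CD: "C \<in> P" "D \<in> P" "C \<noteq> D"
    then have "T ` (A \<inter> C) \<inter> T ` (A \<inter> D) = T ` ((A \<inter> C) \<inter> (A \<inter> D))"
      using A by (intro inj_on_image_Int[OF assms(1), symmetric]) auto
    also have "(A \<inter> C) \<inter> (A \<inter> D) = {}"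
      using CD disjoint_P by (auto simp: disjoint_def)
    finally show "T ` (A \<inter> C) \<inter> T ` (A \<inter> D) = {}" by simp
  qed
  have "emeasure ?M (T ` A) = (\<Sum>C\<in>P. emeasure ?M (T ` (A \<inter> C)))"
    unfolding im_eq using pres' d' finite_P by (intro sum_emeasure[symmetric]) auto
  also have "\<dots> = (\<Sum>C\<in>P. emeasure ?M (A \<inter> C))"
    using pres' by (intro sum.cong) auto
  also have "\<dots> = emeasure ?M (\<Union>C\<in>P. A \<inter> C)"
    using piece d finite_P by (intro sum_emeasure) auto
  finally show "emeasure ?M (T ` A) = emeasure ?M A"
    using A_eq by simp
qed

text \<open>
  The pieces \<open>T ` C\<close> are recognised by reading \<open>W\<close>, and on each of them the inverse is the permutation
  inverting \<open>T\<close> there.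
\<close>

lemma inverse_in_TM_fix:
  assumes bij: "bij_betw T (configs n k) (configs n k)"
  shows "inv_into (configs n k) T \<in> TM_fix n k"
proof -
  have "\<exists>v \<pi> \<rho>. perm_rule n k W \<pi> \<rho> \<and>
      (\<forall>c'\<in>cylinder n k W c. inv_into (configs n k) T c' = local_perm v \<pi> \<rho> c')"
    if c: "c \<in> configs n k" for c
  proof -
    have "c \<in> (\<Union>C\<in>P. T ` C)"
      using c bij by (simp add: bij_betw_def flip: image_configs)
    then obtain C where C: "C \<in> P" "c \<in> T ` C" by blast
    obtain v \<pi> \<rho> where rule: "perm_rule n k W \<pi> \<rho>"
      and loc: "\<And>c. c \<in> C \<Longrightarrow> local_perm v \<pi> \<rho> (T c) = c"
      using inv_piece[OF C(1)] by blast
    have "inv_into (configs n k) T c' = local_perm v \<pi> \<rho> c'" if "c' \<in> cylinder n k W c" for c'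
    proof -
      have "c' \<in> T ` C"
        using image_determined[OF C(1)] C(2) that by (auto simp: determined_def)
      then obtain b where "b \<in> C" "c' = T b" by blast
      moreover have "b \<in> configs n k"
        using \<open>b \<in> C\<close> C(1) cover by blast
      ultimately show ?thesis
        using bij loc by (simp add: bij_betw_def)
    qed
    with rule show ?thesis by blast
  qed
  with finite_W show ?thesis
    unfolding TM_fix_iff_piecewise_local_perm[OF n_pos] by blast
qed

end

theorem theorem2p18:
  fixes n k :: nat
    and T :: "(int ^ 'd::finite \<Rightarrow> nat) \<times> nat \<Rightarrow> (int ^ 'd \<Rightarrow> nat) \<times> nat"
  assumes "n \<ge> 1" and "k \<ge> 1" and "T \<in> TM_fix n k"
  shows "(inj_on T (configs n k) \<longleftrightarrow> T ` configs n k = configs n k) \<and>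
         (inj_on T (configs n k) \<longleftrightarrow> T \<in> RTM_fix n k) \<and>
         (inj_on T (configs n k) \<longleftrightarrow>
           (\<forall>A \<in> sets (uniform_mu n k).
              T -` A \<inter> configs n k \<in> sets (uniform_mu n k) \<and>
              emeasure (uniform_mu n k) (T -` A \<inter> configs n k) = emeasure (uniform_mu n k) A)) \<and>
         (inj_on T (configs n k) \<longleftrightarrow>
           (\<forall>A \<in> sets (uniform_mu n k).
              T ` A \<in> sets (uniform_mu n k) \<and>
              emeasure (uniform_mu n k) (T ` A) = emeasure (uniform_mu n k) A))"
proof -
  let ?X = "configs n k :: 'd config set" and ?M = "uniform_mu n k :: 'd config measure"
  interpret M: prob_space ?M
    by (rule prob_space_uniform_mu) fact+
  obtain P W where "permutation_pieces n k T P W"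
    using TM_fix_imp_permutation_pieces[OF assms] .
  then interpret T: permutation_pieces n k T P W .
  note inj_iff_surj = T.inj_on_iff_surj
  have bij: "bij_betw T ?X ?X" if "inj_on T ?X"
    using that inj_iff_surj by (simp add: bij_betw_def)
  have X_sets: "?X \<in> sets ?M"
    using sets.top[of ?M] by (simp add: space_uniform_mu)
  note N_det = determined_compl[OF T.determined_image_configs]
  \<comment> \<open>Both measure conditions are brought to this form.\<close>
  have surjI: "inj_on T ?X" if "emeasure ?M (?X - T ` ?X) = 0"
    using determined_null_imp_empty[OF assms(1,2) T.finite_W N_det that] T.image_subset
      inj_iff_surj by blast

  have rev: "inj_on T ?X \<longleftrightarrow> T \<in> RTM_fix n k"
  proof
    assume "inj_on T ?X"
    note b = bij[OF this]
    then show "T \<in> RTM_fix n k"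
      using assms(3) T.inverse_in_TM_fix[OF b] unfolding RTM_fix_def
      by (auto intro!: bexI[of _ "inv_into ?X T"] simp: bij_betw_def f_inv_into_f)
  next
    assume "T \<in> RTM_fix n k"
    then show "inj_on T ?X"
      unfolding RTM_fix_def by (auto intro: inj_on_inverseI)
  qed

  have pre: "inj_on T ?X \<longleftrightarrow> (\<forall>A \<in> sets ?M. T -` A \<inter> ?X \<in> sets ?M \<and>
      emeasure ?M (T -` A \<inter> ?X) = emeasure ?M A)"
  proof
    assume "inj_on T ?X"
    note b = bij[OF this]
    \<comment> \<open>Preimages under \<open>T\<close> are images under the inverse, which is a Turing machine as well.\<close>
    let ?S = "inv_into ?X T"
    obtain P' W' where "permutation_pieces n k ?S P' W'"
      using TM_fix_imp_permutation_pieces[OF assms(1,2) T.inverse_in_TM_fix[OF b]] .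
    then interpret S: permutation_pieces n k ?S P' W' .
    show "\<forall>A \<in> sets ?M. T -` A \<inter> ?X \<in> sets ?M \<and> emeasure ?M (T -` A \<inter> ?X) = emeasure ?M A"
    proof
      fix A assume A: "A \<in> sets ?M"
      then have "A \<subseteq> ?X"
        using sets.sets_into_space[of A ?M] by (simp add: space_uniform_mu)
      then have "T -` A \<inter> ?X = ?S ` A"
        by (rule inv_into_image_eq_vimage[OF b, symmetric])
      moreover have "inj_on ?S ?X"
        using bij_betw_inv_into[OF b] by (simp add: bij_betw_def)
      ultimately show "T -` A \<inter> ?X \<in> sets ?M \<and> emeasure ?M (T -` A \<inter> ?X) = emeasure ?M A"
        using S.measure_image[OF _ A] by simp
    qed
  next
    assume "\<forall>A \<in> sets ?M. T -` A \<inter> ?X \<in> sets ?M \<and> emeasure ?M (T -` A \<inter> ?X) = emeasure ?M A"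
    then have "emeasure ?M (?X - T ` ?X) = emeasure ?M (T -` (?X - T ` ?X) \<inter> ?X)"
      using determined_sets[OF assms(1,2) T.finite_W N_det] by simp
    also have "T -` (?X - T ` ?X) \<inter> ?X = {}" by blast
    finally show "inj_on T ?X" by (intro surjI) simp
  qed

  have img: "inj_on T ?X \<longleftrightarrow> (\<forall>A \<in> sets ?M. T ` A \<in> sets ?M \<and> emeasure ?M (T ` A) = emeasure ?M A)"
  proof
    assume "inj_on T ?X"
    then show "\<forall>A \<in> sets ?M. T ` A \<in> sets ?M \<and> emeasure ?M (T ` A) = emeasure ?M A"
      using T.measure_image by blast
  next
    assume "\<forall>A \<in> sets ?M. T ` A \<in> sets ?M \<and> emeasure ?M (T ` A) = emeasure ?M A"
    then have "T ` ?X \<in> sets ?M" "emeasure ?M (T ` ?X) = 1"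
      using X_sets M.emeasure_space_1 by (auto simp: space_uniform_mu)
    then have "emeasure ?M (?X - T ` ?X) = 0"
      using emeasure_compl[of "T ` ?X" ?M] M.emeasure_space_1 by (simp add: space_uniform_mu)
    then show "inj_on T ?X" by (rule surjI)
  qed

  show ?thesis
    using inj_iff_surj rev pre img by blast
qed

end
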